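(* Let $G=(S_1,S_2,E,w)$ be a one-player game in which all states belong to player 1, i.e. $S_2=\emptyset$. For every initial state $s_{init}\in S$ and every threshold $t\in\mathbb{Q}$: if player 1 has a winning strategy from $s_{init}$ for the objective $\mathrm{AvgEnergy}(t)$, then player 1 has a memoryless winning strategy from $s_{init}$ for $\mathrm{AvgEnergy}(t)$.
   Context: A game is a tuple $G=(S_1,S_2,E,w)$ where $S_1,S_2$ are disjoint finite sets of states (belonging to player 1 and player 2 respectively), $S=S_1\uplus S_2$, $E\subseteq S\times S$ is a set of edges such that every $s\in S$ has at least one $s'$ with $(s,s')\in E$, and $w\colon E\to\mathbb{Z}$ is a weight function. A play from $s_{init}$ is an infinite sequence $\pi=s_0s_1s_2\dots$ with $s_0=s_{init}$ and $(s_i,s_{i+1})\in E$ for all $i$; $\pi(n)=s_0\dots s_n$ denotes its prefix with $n$ edges. The energy level is $\mathrm{EL}(\pi(n))=\sum_{i=0}^{n-1}w(s_i,s_{i+1})$, and the average-energy of a play is $\overline{\mathrm{AE}}(\pi)=\limsup_{n\to\infty}\frac1n\sum_{i=1}^{n}\mathrm{EL}(\pi(i))$. A strategy of player $i$ is a function mapping every finite prefix whose last state is in $S_i$ to a state $s'$ with $(\text{last state},s')\in E$; it is memoryless if its choice depends only on the last state of the prefix. A play is consistent with a strategy if at every position where the current state belongs to the strategy's owner, the next state is the one chosen by the strategy. A strategy of player 1 is winning from $s_{init}$ for an objective $\mathcal{W}$ (a set of plays) if every play from $s_{init}$ consistent with it belongs to $\mathcal{W}$. The average-energy objective is $\mathrm{AvgEnergy}(t)=\{\pi\mid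 \overline{\mathrm{AE}}(\pi)\le t\}$ (player 1 aims to minimize the average-energy). *)

theory Defs
  imports Complex_Main "HOL-Library.Extended_Real"
begin

(* The weight function is total for typing reasons; only its values on edges matter. *)
record 's game =
  states1 :: "'s set"
  states2 :: "'s set"
  edges :: "('s \<times> 's) set"
  weight :: "'s \<times> 's \<Rightarrow> int"

datatype player = Player1 | Player2

fun owned :: "'s game \<Rightarrow> player \<Rightarrow> 's set" where
  "owned G Player1 = states1 G"
| "owned G Player2 = states2 G"

definition states :: "'s game \<Rightarrow> 's set" where
  "states G = states1 G \<union> states2 G"

definition wf_game :: "'s game \<Rightarrow> bool" where
  "wf_game G \<longleftrightarrow>
     finite (states1 G) \<and> finite (states2 G) \<and> states1 G \<inter> states2 G = {} \<and>
     edges G \<subseteq> states G \<times> states G \<and>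
     (\<forall>s\<in>states G. \<exists>s'. (s, s') \<in> edges G)"

definition plays :: "'s game \<Rightarrow> (nat \<Rightarrow> 's) set" where
  "plays G = {\<pi>. \<pi> 0 \<in> states G \<and> (\<forall>i. (\<pi> i, \<pi> (Suc i)) \<in> edges G)}"

definition plays_from :: "'s game \<Rightarrow> 's \<Rightarrow> (nat \<Rightarrow> 's) set" where
  "plays_from G s = {\<pi> \<in> plays G. \<pi> 0 = s}"

(* The prefix with n edges, that is, with n + 1 states. *)
definition play_prefix :: "(nat \<Rightarrow> 's) \<Rightarrow> nat \<Rightarrow> 's list" where
  "play_prefix \<pi> n = map \<pi> [0..<Suc n]"

definition prefixes :: "'s game \<Rightarrow> 's list set" where
  "prefixes G = {play_prefix \<pi> n | \<pi> n. \<pi> \<in> plays G}"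

definition energy_level :: "'s game \<Rightarrow> 's list \<Rightarrow> int" where
  "energy_level G \<rho> = (\<Sum>i<length \<rho> - 1. weight G (\<rho> ! i, \<rho> ! Suc i))"

(* The limit superior is taken in the extended reals, as it may be infinite. *)
definition avg_energy :: "'s game \<Rightarrow> (nat \<Rightarrow> 's) \<Rightarrow> ereal" where
  "avg_energy G \<pi> =
     limsup (\<lambda>n. ereal (1 / real n * (\<Sum>i=1..n. real_of_int (energy_level G (play_prefix \<pi> i)))))"

definition AvgEnergy :: "'s game \<Rightarrow> rat \<Rightarrow> (nat \<Rightarrow> 's) set" where
  "AvgEnergy G t = {\<pi> \<in> plays G. avg_energy G \<pi> \<le> ereal (real_of_rat t)}"

(* Strategies are total functions on lists; only their values on prefixes of plays
   that end in a state of the player are constrained or ever used. *)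
definition strategy :: "'s game \<Rightarrow> player \<Rightarrow> ('s list \<Rightarrow> 's) \<Rightarrow> bool" where
  "strategy G p \<sigma> \<longleftrightarrow>
     (\<forall>\<rho>\<in>prefixes G. last \<rho> \<in> owned G p \<longrightarrow> (last \<rho>, \<sigma> \<rho>) \<in> edges G)"

definition memoryless :: "'s game \<Rightarrow> player \<Rightarrow> ('s list \<Rightarrow> 's) \<Rightarrow> bool" where
  "memoryless G p \<sigma> \<longleftrightarrow>
     (\<forall>\<rho>\<in>prefixes G. \<forall>\<rho>'\<in>prefixes G.
        last \<rho> \<in> owned G p \<longrightarrow> last \<rho> = last \<rho>' \<longrightarrow> \<sigma> \<rho> = \<sigma> \<rho>')"

definition consistent :: "'s game \<Rightarrow> player \<Rightarrow> ('s list \<Rightarrow> 's) \<Rightarrow> (nat \<Rightarrow> 's) \<Rightarrow> bool" where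
  "consistent G p \<sigma> \<pi> \<longleftrightarrow>
     (\<forall>n. \<pi> n \<in> owned G p \<longrightarrow> \<pi> (Suc n) = \<sigma> (play_prefix \<pi> n))"

definition winning ::
  "'s game \<Rightarrow> player \<Rightarrow> ('s list \<Rightarrow> 's) \<Rightarrow> 's \<Rightarrow> (nat \<Rightarrow> 's) set \<Rightarrow> bool" where
  "winning G p \<sigma> s W \<longleftrightarrow> (\<forall>\<pi>\<in>plays_from G s. consistent G p \<sigma> \<pi> \<longrightarrow> \<pi> \<in> W)"

end

(* If some reachable cycle has negative weight, circling in it forever gives average-energy -infinity.
   Otherwise let d v be the least weight of a path from the initial state to v, so that the reduced
   weights w(u, v) + d u - d v are nonnegative. Along the given play EL = d + K, where K is the
   nondecreasing sum of the reduced weights; as the average-energy is at most t, the integer K is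
   eventually constant, so the play eventually uses only tight edges (reduced weight 0) and the mean
   of d along its tail is at most t. Hence some simple tight cycle has mean of d at most t, and a
   tight path from the initial state to it yields a lasso along which EL = d. *)
theory Submission
  imports Defs
begin

section \<open>Walks, their weights and simple cycles\<close>

abbreviation walk :: "('s \<times> 's) set \<Rightarrow> 's list \<Rightarrow> bool" where
  "walk E \<equiv> successively (\<lambda>u v. (u, v) \<in> E)"

text \<open>The weight type is left general because the argument uses integer game weights as well
  as shifted real ones.\<close>

fun wsum :: "('s \<times> 's \<Rightarrow> 'a::linordered_idom) \<Rightarrow> 's list \<Rightarrow> 'a" where
  "wsum c (u # v # xs) = c (u, v) + wsum c (v # xs)"
| "wsum c _ = 0"

text \<open>The return to the start is left implicit, so that \<open>distinct\<close> applies; the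
  weight of the cycle is \<open>wsum c (zs @ [hd zs])\<close>. A one-element list encodes a
  self-loop.\<close>

definition simple_cycle :: "('s \<times> 's) set \<Rightarrow> 's list \<Rightarrow> bool" where
  "simple_cycle E zs \<longleftrightarrow> zs \<noteq> [] \<and> distinct zs \<and> walk E (zs @ [hd zs])"

lemma wsum_append: "wsum c (xs @ y # zs) = wsum c (xs @ [y]) + wsum c (y # zs)"
proof (induction xs rule: induct_list012)
  case (2 x)
  then show ?case by (cases zs) auto
qed auto

lemma wsum_map:
  "wsum c (map p [0..<Suc n]) = (\<Sum>i<n. c (p i, p (Suc i)))"
proof (induction n)
  case (Suc n)
  have "map p [0..<Suc (Suc n)] = map p [0..<n] @ p n # [p (Suc n)]" by simp
  then have "wsum c (map p [0..<Suc (Suc n)]) = wsum c (map p [0..<n] @ [p n]) + c (p n, p (Suc n))"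
    using wsum_append[of c "map p [0..<n]" "p n" "[p (Suc n)]"] by simp
  with Suc show ?case by simp
qed auto

lemma walk_map:
  assumes "\<And>i. (p i, p (Suc i)) \<in> E"
  shows "walk E (map p [0..<n])"
  using assms by (auto simp: successively_conv_nth)

lemma wsum_eq_sum_nth: "wsum c xs = (\<Sum>i<length xs - 1. c (xs ! i, xs ! Suc i))"
proof (cases xs)
  case (Cons x ys)
  have "map ((!) xs) [0..<length xs] = xs" by (rule map_nth)
  moreover have "length xs = Suc (length xs - 1)" using Cons by simp
  ultimately show ?thesis using wsum_map[of c "(!) xs" "length xs - 1"] by simp
qed simp

text \<open>A repeated vertex splits a closed walk into two shorter closed walks whose weights add
  up to the original one, so one of the two is negative again.\<close>

lemma negative_simple_cycle:
  assumes "ys \<noteq> []" "walk E (ys @ [hd ys])" "wsum c (ys @ [hd ys]) < 0"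
  shows "\<exists>zs. simple_cycle E zs \<and> wsum c (zs @ [hd zs]) < 0"
  using assms
proof (induction "length ys" arbitrary: ys rule: less_induct)
  case less
  show ?case
  proof (cases "distinct ys")
    case True
    with less.prems show ?thesis by (auto simp: simple_cycle_def)
  next
    case False
    then obtain a b e y where ys: "ys = a @ [y] @ b @ [y] @ e"
      using not_distinct_decomp by blast
    let ?p = "y # b" and ?q = "a @ y # e"
    have hq: "hd ?q = hd ys" using ys by (cases a) auto
    have "wsum c (ys @ [hd ys]) = wsum c (a @ [y]) + wsum c (y # b @ y # e @ [hd ys])"
      using wsum_append[of c a y "b @ y # e @ [hd ys]"] ys by simp
    also have "wsum c (y # b @ y # e @ [hd ys]) = wsum c (?p @ [hd ?p]) + wsum c (y # e @ [hd ys])"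
      using wsum_append[of c "y # b" y "e @ [hd ys]"] by simp
    finally have "wsum c (ys @ [hd ys]) = wsum c (?p @ [hd ?p]) + wsum c (?q @ [hd ?q])"
      unfolding hq using wsum_append[of c a y "e @ [hd ys]"] by simp
    then have neg: "wsum c (?p @ [hd ?p]) < 0 \<or> wsum c (?q @ [hd ?q]) < 0"
      using less.prems(3) by linarith
    have w: "walk E (a @ [y] @ b @ [y] @ e @ [hd ys])"
      using less.prems(2) ys by simp
    have wp: "walk E (?p @ [hd ?p])"
      using w by (auto simp: successively_append_iff successively_Cons hd_append split: if_splits)
    have "walk E (?q @ [hd ys])"
      using w by (auto simp: successively_append_iff successively_Cons)
    then have wq: "walk E (?q @ [hd ?q])" unfolding hq .
    from neg show ?thesis
    proof
      assume "wsum c (?p @ [hd ?p]) < 0"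
      with less.hyps[of ?p] wp ys show ?thesis by auto
    next
      assume "wsum c (?q @ [hd ?q]) < 0"
      with less.hyps[of ?q] wq ys show ?thesis by auto
    qed
  qed
qed

section \<open>Shortest walks in the absence of negative cycles\<close>

context
  fixes E :: "('s \<times> 's) set" and c :: "'s \<times> 's \<Rightarrow> 'a::linordered_idom"
  assumes nonneg: "\<And>zs. simple_cycle E zs \<Longrightarrow> 0 \<le> wsum c (zs @ [hd zs])"
begin

lemma closed_walk_nonneg:
  assumes "ys \<noteq> []" "walk E (ys @ [hd ys])"
  shows "0 \<le> wsum c (ys @ [hd ys])"
  using negative_simple_cycle[OF assms] nonneg by (meson not_le)

text \<open>The stretch between two occurrences of a vertex is a closed walk of nonnegative weight,
  so cutting it out does not increase the weight.\<close>

lemma distinct_walk: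
  assumes "walk E xs" "xs \<noteq> []"
  shows "\<exists>ys. distinct ys \<and> ys \<noteq> [] \<and> walk E ys \<and> hd ys = hd xs \<and> last ys = last xs \<and>
           set ys \<subseteq> set xs \<and> wsum c ys \<le> wsum c xs"
  using assms
proof (induction "length xs" arbitrary: xs rule: less_induct)
  case less
  show ?case
  proof (cases "distinct xs")
    case True
    with less.prems show ?thesis by auto
  next
    case False
    then obtain a b e y where xs: "xs = a @ [y] @ b @ [y] @ e"
      using not_distinct_decomp by blast
    let ?q = "a @ y # e"
    have wp: "walk E ((y # b) @ [hd (y # b)])"
      using less.prems(1) unfolding xs
      by (auto simp: successively_append_iff successively_Cons hd_append)
    have wq: "walk E ?q"
      using less.prems(1) unfolding xs by (auto simp: successively_append_iff successively_Cons)
    have "wsum c xs = wsum c (a @ [y]) + wsum c (y # b @ y # e)"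
      using wsum_append[of c a y "b @ y # e"] xs by simp
    also have "wsum c (y # b @ y # e) = wsum c (y # b @ [y]) + wsum c (y # e)"
      using wsum_append[of c "y # b" y e] by simp
    finally have "wsum c xs = wsum c ?q + wsum c (y # b @ [y])"
      using wsum_append[of c a y e] by simp
    then have le: "wsum c ?q \<le> wsum c xs"
      using closed_walk_nonneg[OF _ wp] by simp
    have *: "hd ?q = hd xs" "last ?q = last xs" "set ?q \<subseteq> set xs" "length ?q < length xs"
      using xs by (cases a; auto)+
    obtain ys where ys: "distinct ys" "ys \<noteq> []" "walk E ys" "hd ys = hd ?q" "last ys = last ?q"
        "set ys \<subseteq> set ?q" "wsum c ys \<le> wsum c ?q"
      using less.hyps[OF *(4) wq] by auto
    show ?thesis
      using ys * le by (intro exI[of _ ys]) (auto intro: order_trans)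
  qed
qed

text \<open>By \<open>distinct_walk\<close>, a lower bound for the finitely many repetition-free
  lists over \<open>V\<close> bounds all walks in \<open>V\<close>.\<close>

lemma wsum_bounded_below:
  assumes "finite V"
  shows "\<exists>B. \<forall>xs. walk E xs \<longrightarrow> xs \<noteq> [] \<longrightarrow> set xs \<subseteq> V \<longrightarrow> B \<le> wsum c xs"
proof -
  let ?D = "{xs. set xs \<subseteq> V \<and> distinct xs}"
  have fin: "finite (wsum c ` ?D)" using finite_subset_distinct[OF assms] by simp
  show ?thesis
  proof (intro exI allI impI)
    fix xs assume "walk E xs" "xs \<noteq> []" "set xs \<subseteq> V"
    then obtain ys where "distinct ys" "set ys \<subseteq> set xs" "wsum c ys \<le> wsum c xs"
      using distinct_walk by blast
    moreover from this \<open>set xs \<subseteq> V\<close> have "wsum c ys \<in> wsum c ` ?D" by blast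
    ultimately show "Min (wsum c ` ?D) \<le> wsum c xs"
      using Min_le[OF fin] order_trans by blast
  qed
qed

text \<open>Only finitely many repetition-free walks compete, so the least weight is attained. Where
  no walk from \<open>s\<close> ends, \<open>d\<close> is a minimum of the empty set and carries no
  information.\<close>

lemma shortest_walks:
  fixes s :: 's
  assumes "finite V"
  obtains d where
    "\<And>xs. walk E xs \<Longrightarrow> xs \<noteq> [] \<Longrightarrow> hd xs = s \<Longrightarrow> set xs \<subseteq> V \<Longrightarrow> d (last xs) \<le> wsum c xs"
    "\<And>xs. walk E xs \<Longrightarrow> xs \<noteq> [] \<Longrightarrow> hd xs = s \<Longrightarrow> set xs \<subseteq> V \<Longrightarrow>
      \<exists>ys. walk E ys \<and> ys \<noteq> [] \<and> hd ys = s \<and> set ys \<subseteq> V \<and> last ys = last xs \<and>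
        wsum c ys = d (last xs)"
proof
  let ?D = "\<lambda>v. {ys. set ys \<subseteq> V \<and> distinct ys \<and> ys \<noteq> [] \<and> walk E ys \<and> hd ys = s \<and> last ys = v}"
  let ?d = "\<lambda>v. Min (wsum c ` ?D v)"
  have fin: "finite (wsum c ` ?D v)" for v
    by (rule finite_imageI, rule finite_subset[OF _ finite_subset_distinct[OF assms]]) auto
  fix xs assume xs: "walk E xs" "xs \<noteq> []" "hd xs = s" "set xs \<subseteq> V"
  obtain ys where ys: "distinct ys \<and> ys \<noteq> [] \<and> walk E ys \<and> hd ys = hd xs \<and> last ys = last xs \<and>
      set ys \<subseteq> set xs \<and> wsum c ys \<le> wsum c xs"
    using distinct_walk[OF xs(1,2)] by blast
  then have in_D: "ys \<in> ?D (last xs)" using xs by auto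
  then have "?d (last xs) \<le> wsum c ys" using fin by (intro Min_le) auto
  then show "?d (last xs) \<le> wsum c xs" using ys by (meson order_trans)
  have "?d (last xs) \<in> wsum c ` ?D (last xs)" using fin in_D by (intro Min_in) auto
  then show "\<exists>ys. walk E ys \<and> ys \<noteq> [] \<and> hd ys = s \<and> set ys \<subseteq> V \<and> last ys = last xs \<and>
        wsum c ys = ?d (last xs)"
    by auto
qed

end

section \<open>Linear growth when all cycles are positive\<close>

lemma wsum_diff_const:
  "wsum (\<lambda>e. c e - k) xs = wsum c xs - k * of_nat (length xs - 1)"
  by (simp add: wsum_eq_sum_nth sum_subtractf algebra_simps)

text \<open>Finitely many simple cycles leave a gap \<open>\<delta>\<close> in mean weight, so that lowering all weights by
  \<open>\<delta>\<close> creates no negative cycle.\<close>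

lemma positive_cycles_linear_growth:
  fixes c :: "'s \<times> 's \<Rightarrow> real"
  assumes "finite V" "E \<subseteq> V \<times> V"
    and pos: "\<And>zs. simple_cycle E zs \<Longrightarrow> 0 < wsum c (zs @ [hd zs])"
  obtains \<delta> B where "\<delta> > 0"
    "\<And>p n. (\<And>i. (p i, p (Suc i)) \<in> E) \<Longrightarrow> B + \<delta> * real n \<le> (\<Sum>i<n. c (p i, p (Suc i)))"
proof -
  let ?Z = "{zs. simple_cycle E zs}"
  let ?m = "\<lambda>zs. wsum c (zs @ [hd zs]) / real (length zs)"
  \<comment> \<open>The least mean weight of a simple cycle; the inserted 1 covers the case that
    there is no cycle.\<close>
  define \<delta> where "\<delta> = Min (insert 1 (?m ` ?Z))"
  have "?Z \<subseteq> {zs. set zs \<subseteq> V \<and> distinct zs}"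
  proof clarify
    fix zs assume zs: "simple_cycle E zs"
    have "set zs \<subseteq> V"
    proof
      fix x assume "x \<in> set zs"
      then obtain a b where "zs = a @ x # b" by (meson split_list)
      with zs assms(2) show "x \<in> V"
        by (cases b) (auto simp: simple_cycle_def successively_append_iff successively_Cons)
    qed
    with zs show "set zs \<subseteq> V \<and> distinct zs" by (simp add: simple_cycle_def)
  qed
  then have "finite ?Z"
    by (rule finite_subset[OF _ finite_subset_distinct[OF assms(1)]])
  then have fin: "finite (insert 1 (?m ` ?Z))" by simp
  have "?m zs > 0" if "simple_cycle E zs" for zs
    using pos[OF that] that by (simp add: simple_cycle_def)
  then have "\<delta> > 0"
    unfolding \<delta>_def using fin by (subst Min_gr_iff) auto
  have nn: "0 \<le> wsum (\<lambda>e. c e - \<delta>) (zs @ [hd zs])" if "simple_cycle E zs" for zs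
  proof -
    have "\<delta> \<le> ?m zs" unfolding \<delta>_def using fin that by (intro Min_le) auto
    moreover have "real (length zs) > 0" using that by (simp add: simple_cycle_def)
    ultimately show ?thesis by (simp add: wsum_diff_const field_simps)
  qed
  \<comment> \<open>The bound is taken for the lowered weights; restoring \<open>\<delta>\<close> on
    each of \<open>n\<close> edges then yields the linear term.\<close>
  obtain B where B: "\<forall>xs. walk E xs \<longrightarrow> xs \<noteq> [] \<longrightarrow> set xs \<subseteq> V \<longrightarrow> B \<le> wsum (\<lambda>e. c e - \<delta>) xs"
    using wsum_bounded_below[of E "\<lambda>e. c e - \<delta>", OF nn assms(1)] by blast
  show thesis
  proof (rule that[OF \<open>\<delta> > 0\<close>, of B])
    fix p :: "nat \<Rightarrow> 's" and n assume p: "\<And>i. (p i, p (Suc i)) \<in> E"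
    have "set (map p [0..<Suc n]) \<subseteq> V" using p assms(2) by auto
    moreover have "map p [0..<Suc n] \<noteq> []" by simp
    ultimately have "B \<le> wsum (\<lambda>e. c e - \<delta>) (map p [0..<Suc n])"
      using B walk_map[of p E "Suc n", OF p] by blast
    then show "B + \<delta> * real n \<le> (\<Sum>i<n. c (p i, p (Suc i)))"
      by (simp only: wsum_map sum_subtractf) (simp add: algebra_simps)
  qed
qed

section \<open>Cyclic indexing and positional lassos\<close>

lemma nth_append_hd:
  assumes "i < length zs"
  shows "(zs @ [hd zs]) ! i = zs ! i" "(zs @ [hd zs]) ! Suc i = zs ! (Suc i mod length zs)"
proof -
  show "(zs @ [hd zs]) ! i = zs ! i" using assms by (simp add: nth_append)
  show "(zs @ [hd zs]) ! Suc i = zs ! (Suc i mod length zs)"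
  proof (cases "Suc i = length zs")
    case True
    moreover have "hd zs = zs ! 0" using assms by (intro hd_conv_nth) auto
    ultimately show ?thesis by (simp only: nth_append_length mod_self)
  next
    case False
    with assms show ?thesis by (simp add: nth_append)
  qed
qed

text \<open>Off the cycle, the successor function decreases the distance to \<open>hd zs\<close>.\<close>

lemma lasso_successor:
  assumes cyc: "simple_cycle E' zs" and reach: "(s, hd zs) \<in> E'\<^sup>*" and sub: "E' \<subseteq> E"
    and total: "\<And>v. v \<in> V \<Longrightarrow> \<exists>u. (v, u) \<in> E"
  obtains f k where "\<And>v. v \<in> V \<Longrightarrow> (v, f v) \<in> E"
    "\<And>n. ((f ^^ n) s, f ((f ^^ n) s)) \<in> E'"
    "\<And>i. (f ^^ (k + i)) s = zs ! (i mod length zs)"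
proof -
  let ?m = "length zs"
  define D where "D v = (LEAST n. (v, hd zs) \<in> E' ^^ n)" for v
  have m: "?m > 0" and dist: "distinct zs" and w: "walk E' (zs @ [hd zs])"
    using cyc by (auto simp: simple_cycle_def)
  have edge: "(zs ! i, zs ! (Suc i mod ?m)) \<in> E'" if "i < ?m" for i
  proof -
    have "((zs @ [hd zs]) ! i, (zs @ [hd zs]) ! Suc i) \<in> E'"
      using w that by (simp add: successively_conv_nth)
    then show ?thesis unfolding nth_append_hd[OF that] .
  qed
  \<comment> \<open>All demands on the choice at \<open>v\<close> are collected for a single use of
    choice. The last two concern vertices on and off the cycle, so they cannot clash.\<close>
  have "\<exists>u. (v \<in> V \<longrightarrow> (v, u) \<in> E) \<and> (\<forall>i<?m. v = zs ! i \<longrightarrow> u = zs ! (Suc i mod ?m)) \<and>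
      (v \<notin> set zs \<longrightarrow> (v, hd zs) \<in> E'\<^sup>* \<longrightarrow>
        (v, u) \<in> E' \<and> (u, hd zs) \<in> E'\<^sup>* \<and> D u < D v)" for v
  proof -
    consider (cycle) i where "i < ?m" "v = zs ! i"
      | (path) "v \<notin> set zs" "(v, hd zs) \<in> E'\<^sup>*" | (off) "v \<notin> set zs" "(v, hd zs) \<notin> E'\<^sup>*"
      by (metis in_set_conv_nth)
    then show ?thesis
    proof cases
      case cycle
      then show ?thesis using edge[of i] sub dist
        by (intro exI[of _ "zs ! (Suc i mod ?m)"]) (auto simp: nth_eq_iff_index_eq)
    next
      case path
      then obtain n where "(v, hd zs) \<in> E' ^^ n" using rtrancl_imp_relpow by blast
      then have Dv: "(v, hd zs) \<in> E' ^^ D v" unfolding D_def by (rule LeastI)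
      have "D v \<noteq> 0"
        using Dv path m by (metis relpow_0_E hd_in_set length_greater_0_conv)
      then obtain j where j: "D v = Suc j" using not0_implies_Suc by blast
      with Dv obtain u where u: "(v, u) \<in> E'" "(u, hd zs) \<in> E' ^^ j"
        by (metis relpow_Suc_D2)
      then have "D u \<le> j" unfolding D_def by (intro Least_le)
      with u j path sub show ?thesis
        by (intro exI[of _ u]) (auto intro: relpow_imp_rtrancl)
    next
      case off
      then show ?thesis using total[of v] by (metis nth_mem)
    qed
  qed
  then obtain f where f: "\<And>v. v \<in> V \<Longrightarrow> (v, f v) \<in> E"
      "\<And>i. i < ?m \<Longrightarrow> f (zs ! i) = zs ! (Suc i mod ?m)"
      "\<And>v. v \<notin> set zs \<Longrightarrow> (v, hd zs) \<in> E'\<^sup>* \<Longrightarrow>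
        (v, f v) \<in> E' \<and> (f v, hd zs) \<in> E'\<^sup>* \<and> D (f v) < D v"
    by metis
  \<comment> \<open>This set contains \<open>s\<close> and is closed under \<open>f\<close>, which
    follows edges of \<open>E'\<close> on it; hence the whole orbit of \<open>s\<close> runs in
    \<open>E'\<close>.\<close>
  let ?R = "set zs \<union> {v. (v, hd zs) \<in> E'\<^sup>*}"
  have step: "(v, f v) \<in> E' \<and> f v \<in> ?R" if "v \<in> ?R" for v
  proof (cases "v \<in> set zs")
    case True
    then obtain i where "i < ?m" "v = zs ! i" by (metis in_set_conv_nth)
    then show ?thesis using edge f(2) m by auto
  qed (use that f(3) in auto)
  have inR: "(f ^^ n) s \<in> ?R" for n
    by (induction n) (use reach step in auto)
  have around: "(f ^^ j) (zs ! i) = zs ! ((i + j) mod ?m)" if "i < ?m" for i j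
  proof (induction j)
    case (Suc j)
    then show ?case using f(2)[of "(i + j) mod ?m"] m by (simp add: mod_Suc_eq)
  qed (use that in simp)
  \<comment> \<open>Off the cycle each step lowers \<open>D\<close>; on the cycle, completing the
    current round leads to \<open>hd zs\<close>.\<close>
  have "\<exists>k. (f ^^ k) v = hd zs" if "v \<in> ?R" for v
    using that
  proof (induction "D v" arbitrary: v rule: less_induct)
    case less
    show ?case
    proof (cases "v \<in> set zs")
      case True
      then obtain i where i: "i < ?m" "v = zs ! i" by (metis in_set_conv_nth)
      have "(f ^^ (?m - i)) v = hd zs"
        using around[of i "?m - i"] i m by (simp add: hd_conv_nth)
      then show ?thesis by blast
    next
      case False
      then obtain k where "(f ^^ k) (f v) = hd zs"
        using less step[of v] f(3)[of v] by blast
      then have "(f ^^ Suc k) v = hd zs" by (simp add: funpow_swap1)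
      then show ?thesis by blast
    qed
  qed
  then obtain k where k: "(f ^^ k) s = hd zs" using inR[of 0] by auto
  show thesis
  proof (rule that[of f k])
    fix i
    have "(f ^^ (k + i)) s = (f ^^ i) (hd zs)" by (simp add: add.commute[of k] funpow_add k)
    then show "(f ^^ (k + i)) s = zs ! (i mod ?m)"
      using around[OF m, of i] m by (simp add: hd_conv_nth)
  qed (use f inR step in auto)
qed

section \<open>Sums over periodic windows and limits of averages\<close>

lemma window_sum_const:
  fixes g :: "nat \<Rightarrow> 'a::ab_group_add"
  assumes "\<And>n. n \<ge> k \<Longrightarrow> g (n + m) = g n" "n \<ge> k"
  shows "(\<Sum>i<m. g (n + i)) = (\<Sum>i<m. g (k + i))"
proof -
  have "(\<Sum>i<m. g (k + j + i)) = (\<Sum>i<m. g (k + i))" for j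
  proof (induction j)
    case (Suc j)
    \<comment> \<open>Sliding the window by one drops \<open>g (k + j)\<close> and gains
      \<open>g (k + j + m)\<close>, which are equal.\<close>
    have "(\<Sum>i<m. g (k + j + i)) + g (k + j + m) = (\<Sum>i<Suc m. g (k + j + i))" by simp
    also have "\<dots> = g (k + j) + (\<Sum>i<m. g (k + Suc j + i))"
      by (subst sum.lessThan_Suc_shift) simp
    finally show ?case using assms(1)[of "k + j"] Suc by simp
  qed simp
  with assms(2) show ?thesis by (metis le_Suc_ex)
qed

text \<open>After division by \<open>n\<close> the constant \<open>B\<close> contributes nothing in
  the limit.\<close>

lemma limsup_average_le:
  fixes a :: "nat \<Rightarrow> real"
  assumes "\<And>n. n \<ge> N \<Longrightarrow> (\<Sum>i=1..n. a i) \<le> B + x * real n"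
  shows "limsup (\<lambda>n. ereal (1 / real n * (\<Sum>i=1..n. a i))) \<le> ereal x"
proof -
  have "(\<lambda>n. B * inverse (real n) + x) \<longlonglongrightarrow> B * 0 + x"
    by (intro tendsto_intros LIMSEQ_inverse_real_of_nat lim_inverse_n)
  then have lim: "(\<lambda>n. ereal (B * inverse (real n) + x)) \<longlonglongrightarrow> ereal x" by simp
  \<comment> \<open>The 1 in \<open>max 1 N\<close> excludes \<open>n = 0\<close>, where the two
    sides collapse to 0 and \<open>x\<close>.\<close>
  have "1 / real n * (\<Sum>i=1..n. a i) \<le> B * inverse (real n) + x" if "n \<ge> max 1 N" for n
    using assms[of n] that by (simp add: field_simps)
  then have "\<forall>\<^sub>F n in sequentially.
      ereal (1 / real n * (\<Sum>i=1..n. a i)) \<le> ereal (B * inverse (real n) + x)"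
    by (intro eventually_sequentiallyI[of "max 1 N"]) simp
  from Limsup_mono[OF this] show ?thesis
    using lim_imp_Limsup[OF _ lim] by simp
qed

lemma limsup_average_ge:
  fixes a :: "nat \<Rightarrow> real"
  assumes "\<And>n. n \<ge> N \<Longrightarrow> B + x * real n \<le> (\<Sum>i=1..n. a i)"
  shows "ereal x \<le> limsup (\<lambda>n. ereal (1 / real n * (\<Sum>i=1..n. a i)))"
proof -
  have "(\<lambda>n. B * inverse (real n) + x) \<longlonglongrightarrow> B * 0 + x"
    by (intro tendsto_intros LIMSEQ_inverse_real_of_nat lim_inverse_n)
  then have lim: "(\<lambda>n. ereal (B * inverse (real n) + x)) \<longlonglongrightarrow> ereal x" by simp
  have "B * inverse (real n) + x \<le> 1 / real n * (\<Sum>i=1..n. a i)" if "n \<ge> max 1 N" for n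
    proof -
    have "B * inverse (real n) + x = (B + x * real n) / real n"
      using that by (simp add: field_simps)
    also have "\<dots> \<le> (\<Sum>i=1..n. a i) / real n"
      using assms[of n] that by (intro divide_right_mono) auto
    finally show ?thesis by simp
  qed
  then have "\<forall>\<^sub>F n in sequentially.
      ereal (B * inverse (real n) + x) \<le> ereal (1 / real n * (\<Sum>i=1..n. a i))"
    by (intro eventually_sequentiallyI[of "max 1 N"]) simp
  from Limsup_mono[OF this] show ?thesis
    using lim_imp_Limsup[OF _ lim] by simp
qed

text \<open>Going back from \<open>n > k + m\<close> in steps of \<open>m\<close> never decreases
  \<open>S\<close> and ends in the finite segment up to \<open>k + m\<close>, whose maximum is the
  bound.\<close>

lemma bounded_above_if_recurrent:
  fixes S :: "nat \<Rightarrow> real"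
  assumes "m > 0" and "\<And>n. n \<ge> k \<Longrightarrow> S (n + m) \<le> S n"
  obtains B where "\<And>n. S n \<le> B"
proof -
  have "S n \<le> Max (S ` {..k + m})" for n
  proof (induction n rule: less_induct)
    case (less n)
    show ?case
    proof (cases "n \<le> k + m")
      case False
      then have "S n \<le> S (n - m)" using assms(2)[of "n - m"] by simp
      also have "\<dots> \<le> Max (S ` {..k + m})" using less[of "n - m"] assms(1) False by simp
      finally show ?thesis .
    qed simp
  qed
  with that show thesis by blast
qed

text \<open>By periodicity the starting point of the window is irrelevant; started at
  \<open>k\<close>, it traverses \<open>zs\<close> exactly once.\<close>

lemma sum_around_cycle:
  fixes p :: "nat \<Rightarrow> 's" and c :: "'s \<times> 's \<Rightarrow> 'a::linordered_idom"
  assumes zs: "zs \<noteq> []" and p: "\<And>i. p (k + i) = zs ! (i mod length zs)" and "n \<ge> k"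
  shows "(\<Sum>i<length zs. c (p (n + i), p (Suc (n + i)))) = wsum c (zs @ [hd zs])"
proof -
  have per: "p (n + length zs) = p n" if n: "n \<ge> k" for n
  proof -
    obtain j where "n = k + j" using le_Suc_ex[OF n] by blast
    then show ?thesis using p[of j] p[of "j + length zs"] by (simp only: add.assoc mod_add_self2)
  qed
  have "(\<Sum>i<length zs. c (p (n + i), p (Suc (n + i)))) =
      (\<Sum>i<length zs. c (p (k + i), p (Suc (k + i))))"
  proof (rule window_sum_const[of k "\<lambda>i. c (p i, p (Suc i))", OF _ \<open>n \<ge> k\<close>])
    fix n assume "n \<ge> k"
    then show "c (p (n + length zs), p (Suc (n + length zs))) = c (p n, p (Suc n))"
      using per[of n] per[of "Suc n"] by (simp only: add_Suc le_SucI)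
  qed
  also have "\<dots> = (\<Sum>i<length zs. c ((zs @ [hd zs]) ! i, (zs @ [hd zs]) ! Suc i))"
  proof (intro sum.cong refl)
    fix i assume i: "i \<in> {..<length zs}"
    have "p (Suc (k + i)) = zs ! (Suc i mod length zs)" using p[of "Suc i"] by simp
    then show "c (p (k + i), p (Suc (k + i))) = c ((zs @ [hd zs]) ! i, (zs @ [hd zs]) ! Suc i)"
      using i p[of i] nth_append_hd[of i zs] by simp
  qed
  also have "\<dots> = wsum c (zs @ [hd zs])" by (simp add: wsum_eq_sum_nth)
  finally show ?thesis .
qed

section \<open>Average level along infinite sequences\<close>

definition level :: "('s \<times> 's \<Rightarrow> int) \<Rightarrow> (nat \<Rightarrow> 's) \<Rightarrow> nat \<Rightarrow> int" where
  "level w p n = (\<Sum>i<n. w (p i, p (Suc i)))"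

lemma level_add:
  "level w p (n + m) = level w p n + (\<Sum>i<m. w (p (n + i), p (Suc (n + i))))"
  by (induction m) (simp_all add: level_def)

text \<open>With \<open>level\<close>, this restates \<open>avg_energy\<close> on the infinite
  sequence itself, without lists of states; see \<open>avg_energy_eq\<close>.\<close>

definition avg_level :: "('s \<times> 's \<Rightarrow> int) \<Rightarrow> (nat \<Rightarrow> 's) \<Rightarrow> ereal" where
  "avg_level w p = limsup (\<lambda>n. ereal (1 / real n * (\<Sum>i=1..n. real_of_int (level w p i))))"

lemma sum_Suc_window:
  fixes a :: "nat \<Rightarrow> 'a::comm_monoid_add"
  shows "(\<Sum>i=1..n + m. a i) = (\<Sum>i=1..n. a i) + (\<Sum>i<m. a (Suc (n + i)))"
  by (induction m) (simp_all add: add.assoc)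

text \<open>Weights are integers, so each round costs at least 1 and the level falls at least
  linearly. It is therefore eventually below any given \<open>t\<close>.\<close>

lemma avg_level_negative_cycle:
  assumes zs: "zs \<noteq> []" and p: "\<And>i. p (k + i) = zs ! (i mod length zs)"
    and neg: "wsum w (zs @ [hd zs]) < 0"
  shows "avg_level w p \<le> ereal t"
proof -
  let ?m = "length zs"
  have m: "?m > 0" using zs by simp
  \<comment> \<open>The added term grows by exactly 1 per round, which the loss of the round
    outweighs or balances.\<close>
  define S where "S n = real_of_int (level w p n) + real n / real ?m" for n
  have "S (n + ?m) \<le> S n" if "n \<ge> k" for n
  proof -
    have "level w p (n + ?m) = level w p n + (\<Sum>i<?m. w (p (n + i), p (Suc (n + i))))"
      by (rule level_add)
    also have "\<dots> \<le> level w p n - 1"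
      using sum_around_cycle[of zs p k n w, OF zs p that] neg by simp
    finally have "real_of_int (level w p (n + ?m)) \<le> real_of_int (level w p n) - 1" by linarith
    then show ?thesis using m by (simp add: S_def add_divide_distrib)
  qed
  from bounded_above_if_recurrent[of ?m k S, OF m this] obtain B where B: "\<And>n. S n \<le> B" by blast
  obtain N :: nat where N: "real N \<ge> (B - t) * real ?m" using real_arch_simple by blast
  have le_t: "real_of_int (level w p n) \<le> t" if "n \<ge> N" for n
  proof -
    have "(B - t) * real ?m \<le> real n" using N that by linarith
    then have "B - t \<le> real n / real ?m" using m by (simp add: pos_le_divide_eq)
    then show ?thesis using B[of n] by (simp add: S_def)
  qed
  \<comment> \<open>From \<open>N\<close> on, each new level is at most \<open>t\<close>, so this
    excess over \<open>t\<close> no longer increases.\<close>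
  define U where "U n = (\<Sum>i=1..n. real_of_int (level w p i)) - t * real n" for n
  have "U (n + 1) \<le> U n" if "n \<ge> N" for n
    using le_t[of "Suc n"] that by (simp add: U_def algebra_simps)
  from bounded_above_if_recurrent[of 1 N U, OF _ this] obtain B' where "\<And>n. U n \<le> B'" by auto
  then show ?thesis
    unfolding avg_level_def by (intro limsup_average_le[of 0 _ B']) (simp add: U_def algebra_simps)
qed

text \<open>\<open>T\<close> consists of the tight edges of \<open>E\<close>.\<close>

lemma avg_level_potential_lasso:
  fixes p :: "nat \<Rightarrow> 's"
  assumes fin: "finite V" and EV: "E \<subseteq> V \<times> V" and s: "s \<in> V"
    and nonneg: "\<And>zs. simple_cycle E zs \<Longrightarrow> 0 \<le> wsum w (zs @ [hd zs])"
    and p0: "p 0 = s" and p: "\<And>i. (p i, p (Suc i)) \<in> E"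
    and avg: "avg_level w p \<le> ereal t"
  obtains T zs where "T \<subseteq> E" "simple_cycle T zs" "(s, hd zs) \<in> T\<^sup>*"
    "\<And>q k. q 0 = s \<Longrightarrow> (\<And>i. (q i, q (Suc i)) \<in> T) \<Longrightarrow>
      (\<And>i. q (k + i) = zs ! (i mod length zs)) \<Longrightarrow> avg_level w q \<le> ereal t"
proof -
  define W where "W xs \<longleftrightarrow> walk E xs \<and> xs \<noteq> [] \<and> hd xs = s \<and> set xs \<subseteq> V" for xs
  obtain d where
    d: "\<And>xs. walk E xs \<Longrightarrow> xs \<noteq> [] \<Longrightarrow> hd xs = s \<Longrightarrow> set xs \<subseteq> V \<Longrightarrow> d (last xs) \<le> wsum w xs"
    "\<And>xs. walk E xs \<Longrightarrow> xs \<noteq> [] \<Longrightarrow> hd xs = s \<Longrightarrow> set xs \<subseteq> V \<Longrightarrow>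
      \<exists>ys. walk E ys \<and> ys \<noteq> [] \<and> hd ys = s \<and> set ys \<subseteq> V \<and> last ys = last xs \<and>
        wsum w ys = d (last xs)"
    using shortest_walks[of E w V s, OF nonneg fin] by blast
  have d_le: "d (last xs) \<le> wsum w xs" if "W xs" for xs
    using d(1) that by (simp add: W_def)
  have d_ex: "\<exists>ys. W ys \<and> last ys = last xs \<and> wsum w ys = d (last xs)" if "W xs" for xs
    using d(2)[of xs] that unfolding W_def by fast
  \<comment> \<open>The vertices reached from \<open>s\<close>, on which \<open>d\<close> is known
    to be a genuine distance.\<close>
  define R where "R = last ` Collect W"
  have W_snoc: "W (xs @ [v])" if "W xs" "(last xs, v) \<in> E" for xs v
    using that EV by (auto simp: W_def successively_append_iff)
  have wsum_snoc: "wsum w (xs @ [v]) = wsum w xs + w (last xs, v)" if "xs \<noteq> []" for xs v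
    using wsum_append[of w "butlast xs" "last xs" "[v]"] append_butlast_last_id[OF that]
    by (metis append_Cons append_Nil append_assoc add.right_neutral wsum.simps(1,3))
  have R_step: "v \<in> R" "d v \<le> d u + w (u, v)" if u: "u \<in> R" and uv: "(u, v) \<in> E" for u v
  proof -
    obtain ys where ys: "W ys" "last ys = u" "wsum w ys = d u"
      using u d_ex unfolding R_def by (metis imageE mem_Collect_eq)
    then have "W (ys @ [v])" using W_snoc uv by blast
    then show "v \<in> R" unfolding R_def by force
    have "ys \<noteq> []" using ys by (simp add: W_def)
    then show "d v \<le> d u + w (u, v)" using d_le[OF \<open>W (ys @ [v])\<close>] ys wsum_snoc by simp
  qed
  have Ws: "W [s]" using s by (simp add: W_def)
  then have sR: "s \<in> R" unfolding R_def by force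
  \<comment> \<open>The one-vertex walk gives \<open>d s \<le> 0\<close>; any walk from
    \<open>s\<close> back to \<open>s\<close> is closed and hence nonnegative.\<close>
  have ds: "d s = 0"
  proof -
    obtain ys where ys: "W ys" "last ys = s" "wsum w ys = d s" using d_ex[OF Ws] by auto
    have "0 \<le> wsum w ys"
    proof (cases "butlast ys = []")
      case True
      then show ?thesis by (cases ys; cases "tl ys") (auto split: if_splits)
    next
      case False
      have "ys = butlast ys @ [hd (butlast ys)]"
        using ys False by (metis W_def append_butlast_last_id hd_append2)
      then show ?thesis
        using closed_walk_nonneg[of E w "butlast ys", OF nonneg False] ys unfolding W_def by metis
    qed
    with ys d_le[OF Ws] show ?thesis by simp
  qed
  define T where "T = {(u, v) \<in> E. u \<in> R \<and> d v = d u + w (u, v)}"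
  \<comment> \<open>The triangle inequality makes every nonempty prefix of a shortest walk shortest,
    so all its edges are tight.\<close>
  have "(s, last xs) \<in> T\<^sup>*" if "W xs" "wsum w xs = d (last xs)" for xs
    using that
  proof (induction xs rule: rev_induct)
    case (snoc v xs)
    show ?case
    proof (cases "xs = []")
      case True
      with snoc.prems show ?thesis by (simp add: W_def)
    next
      case False
      with snoc.prems have xs: "W xs" "(last xs, v) \<in> E"
        by (auto simp: W_def successively_append_iff)
      then have R: "last xs \<in> R" unfolding R_def by blast
      have "wsum w xs = d (last xs)" "d v = d (last xs) + w (last xs, v)"
        using R_step(2)[OF R xs(2)] d_le[OF xs(1)] snoc.prems(2) wsum_snoc[OF False] by auto
      with snoc.IH xs R have "(s, last xs) \<in> T\<^sup>*" "(last xs, v) \<in> T" by (auto simp: T_def)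
      then show ?thesis by simp
    qed
  qed (simp add: W_def)
  then have T_reach: "(s, v) \<in> T\<^sup>*" if "v \<in> R" for v
    using that d_ex unfolding R_def by (metis imageE mem_Collect_eq)

  have pR: "p i \<in> R" for i
    by (induction i) (use p0 sR R_step p in auto)
  have pV: "p i \<in> V" for i using p EV by auto
  define K where "K i = level w p i - d (p i)" for i
  have K_step: "K i \<le> K (Suc i)" for i
    using R_step(2)[OF pR p, of i] by (simp add: K_def level_def)
  then have K_mono: "K i \<le> K j" if "i \<le> j" for i j
    using that lift_Suc_mono_le by blast
  have K0: "K 0 = 0" by (simp add: K_def level_def p0 ds)
  define D where "D = Min (d ` V)"
  have D: "D \<le> d (p i)" for i using fin pV by (simp add: D_def)
  \<comment> \<open>Otherwise, as \<open>K\<close> is monotone and \<open>d\<close> is at least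
    \<open>D\<close> on the play, all levels from \<open>N\<close> on are at least
    \<open>t + 1\<close>, and so is their average.\<close>
  have "K N \<le> \<lceil>t\<rceil> - D" for N
  proof (rule ccontr)
    assume "\<not> K N \<le> \<lceil>t\<rceil> - D"
    then have lev: "level w p n \<ge> \<lceil>t\<rceil> + 1" if "n \<ge> N" for n
      using K_mono[OF that] D[of n] by (simp add: K_def)
    have ge: "real_of_int (level w p n) \<ge> t + 1" if "n \<ge> N" for n
      using lev[OF that] by linarith
    define S where "S n = (t + 1) * real n - (\<Sum>i=1..n. real_of_int (level w p i))" for n
    have "S (n + 1) \<le> S n" if "n \<ge> N" for n
      using ge[of "Suc n"] that by (simp add: S_def algebra_simps)
    from bounded_above_if_recurrent[of 1 N S, OF _ this] obtain B where "\<And>n. S n \<le> B" by auto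
    then have "ereal (t + 1) \<le> avg_level w p"
      unfolding avg_level_def
      by (intro limsup_average_ge[of 0 "- B"]) (simp add: S_def algebra_simps)
    with avg have "ereal (t + 1) \<le> ereal t" by (rule order_trans[rotated])
    then show False by simp
  qed
  \<comment> \<open>A monotone integer sequence with finitely many values attains its maximum and
    stays there.\<close>
  then have "range K \<subseteq> {0..\<lceil>t\<rceil> - D}" using K_mono[of 0] K0 by auto
  then have finK: "finite (range K)" by (rule finite_subset) simp
  then obtain N where N: "K N = Max (range K)" using Max_in[OF finK]
    by (metis UNIV_not_empty image_is_empty rangeE)
  have K_const: "K n = K N" if "n \<ge> N" for n
    using K_mono[OF that] N Max_ge[OF finK, of "K n"] by simp

  \<comment> \<open>Charges an edge with the potential of its target minus \<open>t\<close>; a cycle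
    then has weight at most 0 exactly when the mean of \<open>d\<close> on it is at most
    \<open>t\<close>.\<close>
  define c where "c e = real_of_int (d (snd e)) - t" for e :: "'s \<times> 's"
  \<comment> \<open>If all tight cycles were positive for \<open>c\<close>, linear growth on the
    tight tail of \<open>p\<close> would raise the average to at least
    \<open>t + \<delta>\<close>.\<close>
  have "\<exists>zs. simple_cycle T zs \<and> wsum c (zs @ [hd zs]) \<le> 0"
  proof (rule ccontr)
    assume "\<nexists>zs. simple_cycle T zs \<and> wsum c (zs @ [hd zs]) \<le> 0"
    then have pos: "\<And>zs. simple_cycle T zs \<Longrightarrow> 0 < wsum c (zs @ [hd zs])" by force
    have TV: "T \<subseteq> V \<times> V" using EV by (auto simp: T_def)
    obtain \<delta> B where \<delta>: "\<delta> > 0" and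
      B: "\<And>q n. (\<And>i. (q i, q (Suc i)) \<in> T) \<Longrightarrow> B + \<delta> * real n \<le> (\<Sum>i<n. c (q i, q (Suc i)))"
      using positive_cycles_linear_growth[of V T c, OF fin TV pos] by blast
    have tail: "(p (N + i), p (Suc (N + i))) \<in> T" for i
      using K_const[of "N + i"] K_const[of "Suc (N + i)"] p pR
      by (simp add: T_def K_def level_def)
    \<comment> \<open>Absorbs the levels up to \<open>N\<close> and the shift of the tail by
      \<open>N\<close> edges.\<close>
    define C where "C = (\<Sum>i=1..N. real_of_int (level w p i)) + B - (t + \<delta>) * real N"
    have "C + (t + \<delta>) * real n \<le> (\<Sum>i=1..n. real_of_int (level w p i))" if n: "n \<ge> N" for n
    proof -
      obtain j where j: "n = N + j" using le_Suc_ex[OF n] by blast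
      have "B + \<delta> * real j \<le> (\<Sum>i<j. c (p (N + i), p (N + Suc i)))"
        using B[of "\<lambda>i. p (N + i)" j] tail by simp
      also have "\<dots> \<le> (\<Sum>i<j. real_of_int (level w p (Suc (N + i))) - t)"
      proof (intro sum_mono)
        fix i
        \<comment> \<open>Since the level is \<open>d\<close> plus a nonnegative \<open>K\<close>,
          potentials bound levels from below.\<close>
        have "0 \<le> K (Suc (N + i))" using K_mono[of 0] K0 by simp
        then show "c (p (N + i), p (N + Suc i)) \<le> real_of_int (level w p (Suc (N + i))) - t"
          by (simp add: c_def K_def)
      qed
      finally show ?thesis
        unfolding j sum_Suc_window by (simp add: C_def sum_subtractf algebra_simps)
    qed
    then have "ereal (t + \<delta>) \<le> avg_level w p"
      unfolding avg_level_def by (intro limsup_average_ge)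
    with avg have "ereal (t + \<delta>) \<le> ereal t" by (rule order_trans[rotated])
    with \<delta> show False by simp
  qed
  then obtain zs where zs: "simple_cycle T zs" "wsum c (zs @ [hd zs]) \<le> 0" by blast
  have "hd zs \<in> R"
    using zs(1) by (cases zs; cases "tl zs") (auto simp: simple_cycle_def T_def)
  show thesis
  proof (rule that[of T zs])
    fix q k
    assume q0: "q 0 = s" and qT: "\<And>i. (q i, q (Suc i)) \<in> T"
      and q: "\<And>i. q (k + i) = zs ! (i mod length zs)"
    \<comment> \<open>Starting from \<open>d s = 0\<close>, each tight edge changes level and
      potential by the same amount.\<close>
    have lev: "level w q n = d (q n)" for n
    proof (induction n)
      case (Suc n)
      then show ?case using qT[of n] by (simp add: level_def T_def)
    qed (simp add: level_def q0 ds)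
    have ne: "zs \<noteq> []" using zs(1) by (simp add: simple_cycle_def)
    define S where "S n = (\<Sum>i=1..n. real_of_int (level w q i)) - t * real n" for n
    have "S (n + length zs) \<le> S n" if "n \<ge> k" for n
    proof -
      have "S (n + length zs) = S n + (\<Sum>i<length zs. c (q (n + i), q (Suc (n + i))))"
        unfolding S_def sum_Suc_window lev by (simp add: c_def sum_subtractf algebra_simps)
      then show ?thesis using sum_around_cycle[of zs q k n c, OF ne q that] zs(2) by simp
    qed
    from bounded_above_if_recurrent[of "length zs" k S, OF _ this]
    obtain B where "\<And>n. S n \<le> B" using ne by auto
    then show "avg_level w q \<le> ereal t"
      unfolding avg_level_def
      by (intro limsup_average_le[of 0 _ B]) (simp add: S_def algebra_simps)
  qed (use zs T_reach \<open>hd zs \<in> R\<close> in \<open>auto simp: T_def\<close>)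
qed

text \<open>Both a reachable negative cycle and a suitable tight cycle can serve as the loop of a
  lasso, and \<open>lasso_successor\<close> turns the lasso into a choice at every vertex.\<close>

lemma positional_avg_level:
  fixes p :: "nat \<Rightarrow> 's"
  assumes fin: "finite V" and EV: "E \<subseteq> V \<times> V" and s: "s \<in> V"
    and total: "\<And>v. v \<in> V \<Longrightarrow> \<exists>u. (v, u) \<in> E"
    and p0: "p 0 = s" and p: "\<And>i. (p i, p (Suc i)) \<in> E"
    and avg: "avg_level w p \<le> ereal t"
  obtains f where "\<And>v. v \<in> V \<Longrightarrow> (v, f v) \<in> E" "avg_level w (\<lambda>i. (f ^^ i) s) \<le> ereal t"
proof -
  \<comment> \<open>Negative cycles out of reach of \<open>s\<close> must not count, so the case
    distinction is made on edges leaving reachable vertices.\<close>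
  define Er where "Er = {(u, v) \<in> E. (s, u) \<in> E\<^sup>*}"
  have sub: "Er \<subseteq> E" by (auto simp: Er_def)
  show thesis
  proof (cases "\<exists>zs. simple_cycle Er zs \<and> wsum w (zs @ [hd zs]) < 0")
    case True
    then obtain zs where zs: "simple_cycle Er zs" "wsum w (zs @ [hd zs]) < 0" by blast
    have cyc: "simple_cycle E zs"
      using zs(1) sub by (auto simp: simple_cycle_def elim!: successively_mono)
    have reach: "(s, hd zs) \<in> E\<^sup>*"
      using zs(1) by (cases zs; cases "tl zs") (auto simp: simple_cycle_def Er_def)
    show thesis
    proof (rule lasso_successor[of E zs s E V, OF cyc reach order_refl total])
      fix f k
      assume f: "\<And>v. v \<in> V \<Longrightarrow> (v, f v) \<in> E"
        "\<And>i. (f ^^ (k + i)) s = zs ! (i mod length zs)"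
      have "zs \<noteq> []" using zs(1) by (simp add: simple_cycle_def)
      then have "avg_level w (\<lambda>i. (f ^^ i) s) \<le> ereal t"
        by (rule avg_level_negative_cycle[of zs _ k, OF _ f(2) zs(2)])
      with f(1) show thesis by (rule that)
    qed
  next
    case False
    then have nonneg: "\<And>zs. simple_cycle Er zs \<Longrightarrow> 0 \<le> wsum w (zs @ [hd zs])" by force
    have "(s, p i) \<in> E\<^sup>*" for i
      by (induction i) (use p0 p in \<open>auto intro: rtrancl_into_rtrancl\<close>)
    then have pEr: "(p i, p (Suc i)) \<in> Er" for i using p by (simp add: Er_def)
    obtain T zs where T: "T \<subseteq> Er" "simple_cycle T zs" "(s, hd zs) \<in> T\<^sup>*"
      and lasso: "\<And>q k. q 0 = s \<Longrightarrow> (\<And>i. (q i, q (Suc i)) \<in> T) \<Longrightarrow>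
        (\<And>i. q (k + i) = zs ! (i mod length zs)) \<Longrightarrow> avg_level w q \<le> ereal t"
      using avg_level_potential_lasso[OF fin order_trans[OF sub EV] s nonneg p0 pEr avg] by metis
    show thesis
    proof (rule lasso_successor[of T zs s E V, OF T(2,3) order_trans[OF T(1) sub] total])
      fix f k
      assume f: "\<And>v. v \<in> V \<Longrightarrow> (v, f v) \<in> E"
        "\<And>n. ((f ^^ n) s, f ((f ^^ n) s)) \<in> T"
        "\<And>i. (f ^^ (k + i)) s = zs ! (i mod length zs)"
      have "avg_level w (\<lambda>i. (f ^^ i) s) \<le> ereal t"
        by (rule lasso[of _ k]) (simp_all add: f(2,3))
      with f(1) show thesis by (rule that)
    qed
  qed
qed

section \<open>Transfer to plays and strategies of the game\<close>

lemma avg_energy_eq: "avg_energy G p = avg_level (weight G) p"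
proof -
  have "energy_level G (play_prefix p n) = level (weight G) p n" for n
    using wsum_map[of "weight G" p n]
    by (simp only: energy_level_def play_prefix_def level_def wsum_eq_sum_nth)
  then show ?thesis by (simp add: avg_energy_def avg_level_def)
qed

text \<open>\<open>prefixes\<close> is defined through infinite plays; a finite walk extends to one
  because every state has a successor.\<close>

lemma walk_in_prefixes:
  assumes wf: "wf_game G" and xs: "walk (edges G) xs" "xs \<noteq> []" "set xs \<subseteq> states G"
  shows "xs \<in> prefixes G"
proof -
  obtain g where g: "\<And>v. v \<in> states G \<Longrightarrow> (v, g v) \<in> edges G"
    using wf unfolding wf_game_def by metis
  have EV: "edges G \<subseteq> states G \<times> states G" using wf by (simp add: wf_game_def)
  let ?n = "length xs - 1"
  define p where "p i = (if i \<le> ?n then xs ! i else (g ^^ (i - ?n)) (last xs))" for i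
  have gV: "(g ^^ i) (last xs) \<in> states G" for i
    by (induction i) (use xs g EV in \<open>auto simp: subset_iff\<close>)
  have p_ge: "p i = (g ^^ (i - ?n)) (last xs)" if "i \<ge> ?n" for i
    using that xs(2) by (cases "i = ?n") (auto simp: p_def last_conv_nth)
  have "(p i, p (Suc i)) \<in> edges G" for i
  proof (cases "i < ?n")
    case True
    with xs(1) show ?thesis by (simp add: p_def successively_conv_nth)
  next
    case False
    then show ?thesis using p_ge[of i] p_ge[of "Suc i"] g[OF gV] by (simp add: Suc_diff_le)
  qed
  moreover have "p 0 \<in> states G" using xs by (auto simp: p_def subset_iff)
  ultimately have "p \<in> plays G" by (simp add: plays_def)
  moreover have "play_prefix p ?n = xs"
    using xs(2) by (intro nth_equalityI) (auto simp: play_prefix_def p_def nth_append)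
  ultimately show ?thesis unfolding prefixes_def by (metis (mono_tags, lifting) mem_Collect_eq)
qed

text \<open>\<open>winning\<close> quantifies over consistent plays, so one must be exhibited to
  extract an average-energy bound. With every state owned by player 1, iterating
  \<open>\<sigma>\<close> on histories produces it.\<close>

lemma consistent_play_exists:
  assumes wf: "wf_game G" and one: "states2 G = {}" and s: "s \<in> states G"
    and \<sigma>: "strategy G Player1 \<sigma>"
  obtains p where "p \<in> plays_from G s" "consistent G Player1 \<sigma> p"
proof -
  have EV: "edges G \<subseteq> states G \<times> states G" using wf by (simp add: wf_game_def)
  define h where "h n = ((\<lambda>xs. xs @ [\<sigma> xs]) ^^ n) [s]" for n
  define p where "p n = last (h n)" for n
  have h_Suc: "h (Suc n) = h n @ [\<sigma> (h n)]" for n by (simp add: h_def)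
  \<comment> \<open>\<open>strategy\<close> constrains \<open>\<sigma>\<close> on prefixes of plays
    only, hence \<open>walk_in_prefixes\<close>.\<close>
  have step: "(last (h n), \<sigma> (h n)) \<in> edges G"
    if "walk (edges G) (h n)" "h n \<noteq> []" "set (h n) \<subseteq> states G" for n
    using \<sigma> walk_in_prefixes[OF wf that] that one last_in_set[OF that(2)]
    by (simp add: strategy_def states_def subset_iff)
  have h: "walk (edges G) (h n) \<and> h n \<noteq> [] \<and> set (h n) \<subseteq> states G" for n
  proof (induction n)
    case 0
    then show ?case using s by (simp add: h_def)
  next
    case (Suc n)
    with step[of n] EV show ?case by (auto simp: h_Suc successively_append_iff)
  qed
  then have edge: "(last (h n), \<sigma> (h n)) \<in> edges G" for n using step by blast
  have pre: "play_prefix p n = h n" for n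
    by (induction n) (simp_all add: play_prefix_def p_def h_Suc, simp add: h_def)
  have "(p n, p (Suc n)) \<in> edges G" for n using edge[of n] by (simp add: p_def h_Suc)
  moreover have "p 0 = s" by (simp add: p_def h_def)
  ultimately have "p \<in> plays_from G s" using s by (simp add: plays_from_def plays_def)
  moreover have "consistent G Player1 \<sigma> p"
    by (simp add: consistent_def pre) (simp add: p_def h_Suc)
  ultimately show thesis using that by blast
qed

theorem theorem1:
  fixes G :: "'s game" and s_init :: 's and t :: rat
  assumes "wf_game G"
    and "states2 G = {}"
    and "s_init \<in> states G"
    and "\<exists>\<sigma>. strategy G Player1 \<sigma> \<and> winning G Player1 \<sigma> s_init (AvgEnergy G t)"
  shows "\<exists>\<sigma>. strategy G Player1 \<sigma> \<and> memoryless G Player1 \<sigma> \<and>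
             winning G Player1 \<sigma> s_init (AvgEnergy G t)"
proof -
  obtain \<sigma> where \<sigma>: "strategy G Player1 \<sigma>" "winning G Player1 \<sigma> s_init (AvgEnergy G t)"
    using assms(4) by blast
  obtain p where p: "p \<in> plays_from G s_init" "consistent G Player1 \<sigma> p"
    using consistent_play_exists[OF assms(1-3) \<sigma>(1)] by blast
  with \<sigma>(2) have avg: "avg_level (weight G) p \<le> ereal (real_of_rat t)"
    by (auto simp: winning_def AvgEnergy_def avg_energy_eq)
  have S: "states1 G = states G" using assms(2) by (simp add: states_def)
  have fin: "finite (states G)" and EV: "edges G \<subseteq> states G \<times> states G"
    and total: "\<And>v. v \<in> states G \<Longrightarrow> \<exists>u. (v, u) \<in> edges G"
    using assms(1) by (auto simp: wf_game_def states_def)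
  have p0: "p 0 = s_init" and pE: "\<And>i. (p i, p (Suc i)) \<in> edges G"
    using p(1) by (auto simp: plays_from_def plays_def)
  obtain f where f: "\<And>v. v \<in> states G \<Longrightarrow> (v, f v) \<in> edges G"
      "avg_level (weight G) (\<lambda>i. (f ^^ i) s_init) \<le> ereal (real_of_rat t)"
    using positional_avg_level[OF fin EV assms(3) total p0 pE avg] by blast
  show ?thesis
  proof (intro exI[of _ "\<lambda>\<rho>. f (last \<rho>)"] conjI)
    show "strategy G Player1 (\<lambda>\<rho>. f (last \<rho>))" using f(1) by (simp add: strategy_def S)
    show "memoryless G Player1 (\<lambda>\<rho>. f (last \<rho>))" by (simp add: memoryless_def)
    show "winning G Player1 (\<lambda>\<rho>. f (last \<rho>)) s_init (AvgEnergy G t)"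
      unfolding winning_def
    proof (intro ballI impI)
      fix q assume q: "q \<in> plays_from G s_init" and con: "consistent G Player1 (\<lambda>\<rho>. f (last \<rho>)) q"
      have "q n \<in> states G" for n
        using q EV by (auto simp: plays_from_def plays_def)
      then have step: "q (Suc n) = f (q n)" for n
        using con by (simp add: consistent_def S play_prefix_def)
      \<comment> \<open>The orbit of \<open>s_init\<close> under \<open>f\<close> is the only
        candidate for a consistent play, so bounding its average suffices.\<close>
      have "q n = (f ^^ n) s_init" for n
        by (induction n) (use q step in \<open>auto simp: plays_from_def\<close>)
      then have "q = (\<lambda>n. (f ^^ n) s_init)" by blast
      with f(2) q show "q \<in> AvgEnergy G t"
        by (simp add: AvgEnergy_def avg_energy_eq plays_from_def)
    qed
  qed
qed

end
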